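(* Let $1\le k\le n$, let $\mathbb T_n^k$ be the simplicial complex on $[n]$ with facets $F_i=[n]\setminus\{i\}$ for $i=1,\dots,k$, and let $\mathcal I=\bigcap_{i=1}^k F_i=[n]\setminus[k]$. Let $\mathcal J\subset 2^{[n]}$ be the set of all subsets of $[n]$ of even cardinality. For $S\subset[n]$ define the linear functional $\mathbf c^S$ on $\mathbb R^{\overline{\mathbb T_n^k}}$ by $c^S_F=0$ if $\#(S\cap F)$ is odd and $c^S_F=1$ if $\#(S\cap F)$ is even. Then the polytope $\mathrm{GCut}(\mathbb T_n^k)$ has the $\mathcal H$-description $$\mathrm{switch}_{\mathcal J}\left(\mathbf c^S\cdot\mathbf x\le 2^{n-2}\ \middle|\ S\subset[n],\ S\cap\mathcal I=\emptyset,\ \#S\text{ is odd}\right);$$ that is, $\mathrm{GCut}(\mathbb T_n^k)$ is the set of all $\mathbf x\in\mathbb R^{\overline{\mathbb T_n^k}}$ satisfying all the inequalities obtained by switching each of the inequalities $\mathbf c^S\cdot\mathbf x\le 2^{n-2}$ ($S\subset[n]$, $S\cap\mathcal I=\emptyset$, $\#S$ odd) with respect to each $I\in\mathcal J$.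
   Context: For a simplicial complex $\Delta$ on $[n]=\{1,\dots,n\}$ (a nonempty family of subsets of $[n]$ closed under taking subsets), $\overline\Delta=\Delta\setminus\{\emptyset\}$. The facets are the inclusion-maximal faces. The generalized cut polytope is $\mathrm{GCut}(\Delta)=\mathrm{conv}\{\mathbf d^S : S\subset[n]\}\subset\mathbb R^{\overline\Delta}$, where for $F\in\overline\Delta$, $d^S_F=1$ if $\#(F\cap S)$ is odd and $d^S_F=0$ if $\#(F\cap S)$ is even. Switching: for a valid inequality $\mathbf a\cdot\mathbf x\le a_0$ of $\mathrm{GCut}(\Delta)$ and $I\subset[n]$, define $a^{(I)}_F=(-1)^{\#(I\cap F)}a_F$ for $F\in\overline\Delta$. The switching of the inequality with respect to $I$ is $\mathbf a^{(I)}\cdot\mathbf x\le a_0-\mathbf a\cdot\mathbf d^I$. For a family $\mathcal J$ of subsets of $[n]$, $\mathrm{switch}_{\mathcal J}(\mathbf a\cdot\mathbf x\le a_0)$ is the set of switchings with respect to all $I\in\mathcal J$; for a set of inequalities, $\mathrm{switch}_{\mathcal J}$ is the union over the inequalities in the set. *)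

theory Defs
  imports "HOL-Analysis.Analysis" "HOL-Library.Function_Algebras"
begin

(* Pointwise real vector space structure on functions, so that the library's
   convex hull applies to vectors indexed by faces. *)

instantiation "fun" :: (type, real_vector) real_vector
begin

definition scaleR_fun_def: "r *\<^sub>R f = (\<lambda>x. r *\<^sub>R f x)"

instance
  by standard (simp_all add: fun_eq_iff scaleR_fun_def scaleR_add_left scaleR_add_right)

end

lemma scaleR_fun_apply [simp]: "(r *\<^sub>R f) x = r *\<^sub>R f x"
  by (simp add: scaleR_fun_def)


definition simplicial_complex :: "nat \<Rightarrow> nat set set \<Rightarrow> bool" where
  "simplicial_complex n \<Delta> \<longleftrightarrow>
     \<Delta> \<noteq> {} \<and> \<Delta> \<subseteq> Pow {1..n} \<and> (\<forall>F\<in>\<Delta>. \<forall>G. G \<subseteq> F \<longrightarrow> G \<in> \<Delta>)"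

definition facets :: "nat set set \<Rightarrow> nat set set" where
  "facets \<Delta> = {F \<in> \<Delta>. \<forall>G\<in>\<Delta>. F \<subseteq> G \<longrightarrow> F = G}"

definition nonempty_faces :: "nat set set \<Rightarrow> nat set set" where
  "nonempty_faces \<Delta> = \<Delta> - {{}}"

(* The space of real vectors indexed by the nonempty faces; a vector is encoded as a
   function on all sets of naturals that vanishes off the nonempty faces. *)
definition face_space :: "nat set set \<Rightarrow> (nat set \<Rightarrow> real) set" where
  "face_space \<Delta> = {x. \<forall>F. F \<notin> nonempty_faces \<Delta> \<longrightarrow> x F = 0}"

definition face_dot :: "nat set set \<Rightarrow> (nat set \<Rightarrow> real) \<Rightarrow> (nat set \<Rightarrow> real) \<Rightarrow> real" where
  "face_dot \<Delta> a x = (\<Sum>F\<in>nonempty_faces \<Delta>. a F * x F)"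

definition cut_vector :: "nat set set \<Rightarrow> nat set \<Rightarrow> nat set \<Rightarrow> real" where
  "cut_vector \<Delta> S = (\<lambda>F. if F \<in> nonempty_faces \<Delta> \<and> odd (card (F \<inter> S)) then 1 else 0)"

definition GCut :: "nat \<Rightarrow> nat set set \<Rightarrow> (nat set \<Rightarrow> real) set" where
  "GCut n \<Delta> = convex hull {cut_vector \<Delta> S | S. S \<subseteq> {1..n}}"


(* A pair (a, b) stands for the inequality a . x \<le> b. *)
type_synonym inequality = "(nat set \<Rightarrow> real) \<times> real"

definition switch_wrt :: "nat set set \<Rightarrow> nat set \<Rightarrow> inequality \<Rightarrow> inequality" where
  "switch_wrt \<Delta> I = (\<lambda>(a, b).
     (\<lambda>F. (-1) ^ card (I \<inter> F) * a F, b - face_dot \<Delta> a (cut_vector \<Delta> I)))"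

definition switch :: "nat set set \<Rightarrow> nat set set \<Rightarrow> inequality set \<Rightarrow> inequality set" where
  "switch \<Delta> \<J> Q = {switch_wrt \<Delta> I q | I q. I \<in> \<J> \<and> q \<in> Q}"

definition solution_set :: "nat set set \<Rightarrow> inequality set \<Rightarrow> (nat set \<Rightarrow> real) set" where
  "solution_set \<Delta> Q = {x \<in> face_space \<Delta>. \<forall>(a, b)\<in>Q. face_dot \<Delta> a x \<le> b}"


definition TT :: "nat \<Rightarrow> nat \<Rightarrow> nat set set" where
  "TT n k = {G. \<exists>i\<in>{1..k}. G \<subseteq> {1..n} - {i}}"

definition even_vector :: "nat set set \<Rightarrow> nat set \<Rightarrow> nat set \<Rightarrow> real" where
  "even_vector \<Delta> S = (\<lambda>F. if F \<in> nonempty_faces \<Delta> \<and> even (card (S \<inter> F)) then 1 else 0)"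

lemma TT_unique_complex_with_facets:
  assumes "1 \<le> k" "k \<le> n"
  shows "simplicial_complex n \<Delta> \<and> facets \<Delta> = (\<lambda>i. {1..n} - {i}) ` {1..k} \<longleftrightarrow> \<Delta> = TT n k"
proof
  assume A: "simplicial_complex n \<Delta> \<and> facets \<Delta> = (\<lambda>i. {1..n} - {i}) ` {1..k}"
  then have fin: "finite \<Delta>"
    by (meson finite_Pow_iff finite_atLeastAtMost finite_subset simplicial_complex_def)
  show "\<Delta> = TT n k"
  proof (intro set_eqI iffI)
    fix G assume "G \<in> \<Delta>"
    then obtain M where M: "M \<in> \<Delta>" "G \<subseteq> M" "\<forall>B\<in>\<Delta>. M \<subseteq> B \<longrightarrow> M = B"
      using finite_has_maximal2[OF fin, of G] by blast
    then have "M \<in> facets \<Delta>" by (simp add: facets_def)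
    then obtain i where "i \<in> {1..k}" "M = {1..n} - {i}" using A by blast
    then show "G \<in> TT n k" using M(2) unfolding TT_def by blast
  next
    fix G assume "G \<in> TT n k"
    then obtain i where i: "i \<in> {1..k}" "G \<subseteq> {1..n} - {i}" by (auto simp: TT_def)
    then have "{1..n} - {i} \<in> facets \<Delta>" using A by blast
    then have "{1..n} - {i} \<in> \<Delta>" by (simp add: facets_def)
    with i A show "G \<in> \<Delta>" unfolding simplicial_complex_def by blast
  qed
next
  assume D: "\<Delta> = TT n k"
  have "{} \<in> TT n k" using assms by (auto simp: TT_def)
  then have "simplicial_complex n \<Delta>"
    unfolding simplicial_complex_def D TT_def by blast
  moreover have "facets (TT n k) = (\<lambda>i. {1..n} - {i}) ` {1..k}"
  proof (intro set_eqI iffI)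
    fix F assume F: "F \<in> facets (TT n k)"
    then obtain i where i: "i \<in> {1..k}" "F \<subseteq> {1..n} - {i}"
      by (auto simp: facets_def TT_def)
    then have "{1..n} - {i} \<in> TT n k" by (auto simp: TT_def)
    with F i have "F = {1..n} - {i}" by (auto simp: facets_def)
    with i show "F \<in> (\<lambda>i. {1..n} - {i}) ` {1..k}" by blast
  next
    fix F assume "F \<in> (\<lambda>i. {1..n} - {i}) ` {1..k}"
    then obtain i where i: "i \<in> {1..k}" "F = {1..n} - {i}" by blast
    then have "F \<in> TT n k" by (auto simp: TT_def)
    moreover have "F = G" if G: "G \<in> TT n k" "F \<subseteq> G" for G
    proof -
      obtain j where j: "j \<in> {1..k}" "G \<subseteq> {1..n} - {j}" using G by (auto simp: TT_def)
      have "j \<in> {1..n}" using j(1) assms by simp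
      moreover have "j \<notin> {1..n} - {i}" using i(2) j(2) G(2) by blast
      ultimately have "j = i" by blast
      then show ?thesis using i j G(2) by blast
    qed
    ultimately show "F \<in> facets (TT n k)" by (simp add: facets_def)
  qed
  ultimately show "simplicial_complex n \<Delta> \<and> facets \<Delta> = (\<lambda>i. {1..n} - {i}) ` {1..k}"
    using D by simp
qed

end

theory Submission
  imports Defs
begin

text \<open>
  Read a point \<open>x\<close> of the face space as recording the probabilities \<open>x F\<close> that a random subset of
  \<open>{1..n}\<close> meets \<open>F\<close> in an odd number of elements. Then \<open>1 - 2 * x F\<close> are Fourier coefficients, over
  the group of subsets under symmetric difference, of the distribution of that random set. So the
  generalized cut polytope consists of those \<open>x\<close> for which the coefficients prescribed on the complex
  can be completed by further ones to the transform of a probability distribution on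
  \<open>Pow {1..n}\<close>; as the coefficient at \<open>{}\<close> is \<open>1\<close>, only nonnegativity is at stake.

  For \<open>TT n k\<close> the coefficients left free are those at sets \<open>F \<supseteq> {1..k}\<close>. Completing by zero gives
  a signed distribution, \<open>pseudo_mass\<close> up to the factor \<open>2 ^ n\<close>, and the free coefficients
  change it exactly by functions \<open>walsh {1..k} J * g (J - {1..k})\<close> with \<open>g\<close> arbitrary. The problem
  therefore splits into one problem for each trace \<open>J - {1..k}\<close>, with one real
  unknown: \<open>g\<close> is to be added to the masses of the \<open>J\<close> with an even number of elements in \<open>{1..k}\<close> and
  subtracted from the others without making any of them negative. This is possible iff each sum of an
  even mass and an odd mass with the same trace is nonnegative
  (\<open>exists_nonnegative_completion\<close>).

  Two such sets differ by a set \<open>S \<subseteq> {1..k}\<close> of odd cardinality, and exactly one of them, say \<open>I\<close>,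
  has even cardinality. The sum of the two masses is four times the slack of the inequality
  of \<open>S\<close> switched with respect to \<open>I\<close> (\<open>slack_switched_inequality\<close>), so the switched
  inequalities are exactly the conditions found.
\<close>

section \<open>Walsh functions\<close>

definition walsh :: "nat set \<Rightarrow> nat set \<Rightarrow> real" where
  "walsh F S = (-1) ^ card (F \<inter> S)"

lemma walsh_commute: "walsh F S = walsh S F"
  by (simp add: walsh_def Int_commute)

lemma walsh_empty [simp]: "walsh {} S = 1" "walsh F {} = 1"
  by (simp_all add: walsh_def)

lemma walsh_square [simp]: "walsh F S * walsh F S = 1"
  by (simp add: walsh_def flip: power_mult_distrib)

lemma walsh_singleton: "walsh F {i} = (if i \<in> F then -1 else 1)"
  by (simp add: walsh_def)

lemma walsh_eq_if: "walsh F S = (if even (card (F \<inter> S)) then 1 else -1)"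
  by (simp add: walsh_def)

lemma walsh_superset: "S \<subseteq> F \<Longrightarrow> walsh F S = (if even (card S) then 1 else -1)"
  by (simp add: walsh_eq_if Int_absorb1)

lemma walsh_eq_prod:
  assumes "finite F"
  shows "walsh F S = (\<Prod>i\<in>F. if i \<in> S then -1 else 1)"
  using prod.inter_restrict[OF assms, of "\<lambda>_. -1 :: real" S] by (simp add: walsh_def)

lemma walsh_sym_diff:
  assumes "finite F"
  shows "walsh F (sym_diff S R) = walsh F S * walsh F R"
  unfolding walsh_eq_prod[OF assms] prod.distrib[symmetric] by (rule prod.cong) auto

lemma sum_Pow_toggle_zero:
  fixes f :: "nat set \<Rightarrow> real"
  assumes "i \<in> V" and toggle: "\<And>S. S \<subseteq> V \<Longrightarrow> f (sym_diff S {i}) = - f S"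
  shows "(\<Sum>S\<in>Pow V. f S) = 0"
proof -
  have "(\<Sum>S\<in>Pow V. f S) = (\<Sum>S\<in>Pow V. - f S)"
    by (rule sum.reindex_bij_witness[where i = "\<lambda>S. sym_diff S {i}" and j = "\<lambda>S. sym_diff S {i}"])
       (use assms in auto)
  then show ?thesis by (simp add: sum_negf)
qed

lemma walsh_orthogonal:
  assumes "finite V" "F \<subseteq> V" "G \<subseteq> V"
  shows "(\<Sum>S\<in>Pow V. walsh F S * walsh G S) = (if F = G then 2 ^ card V else 0)"
proof (cases "F = G")
  case True
  then show ?thesis using assms by (simp add: card_Pow)
next
  case False
  then obtain i where i: "i \<in> sym_diff F G" by blast
  have fin: "finite F" "finite G" using assms finite_subset by auto
  have "(\<Sum>S\<in>Pow V. walsh F S * walsh G S) = 0"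
    by (rule sum_Pow_toggle_zero[of i])
       (use i assms in \<open>auto simp: walsh_sym_diff[OF fin(1)] walsh_sym_diff[OF fin(2)] walsh_singleton\<close>)
  with False show ?thesis by simp
qed

section \<open>The complex and its switched inequalities\<close>

lemma mem_TT_iff:
  assumes "k \<le> n"
  shows "F \<in> TT n k \<longleftrightarrow> F \<subseteq> {1..n} \<and> \<not> {1..k} \<subseteq> F"
  using assms by (auto simp: TT_def)

lemma finite_TT: "finite (TT n k)"
  by (rule finite_subset[of _ "Pow {1..n}"]) (auto simp: TT_def)

lemma sum_TT_eq_sum_Pow:
  fixes f :: "nat set \<Rightarrow> real"
  assumes "k \<le> n" and "\<And>F. F \<subseteq> {1..n} \<Longrightarrow> {1..k} \<subseteq> F \<Longrightarrow> f F = 0"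
  shows "(\<Sum>F\<in>TT n k. f F) = (\<Sum>F\<in>Pow {1..n}. f F)"
proof (rule sum.mono_neutral_left)
  show "TT n k \<subseteq> Pow {1..n}" by (auto simp: TT_def)
  show "\<forall>F\<in>Pow {1..n} - TT n k. f F = 0"
    using assms by (simp add: mem_TT_iff)
qed simp

text \<open>
  The inverse Fourier transform of the coefficients \<open>1 - 2 * x F\<close>, completed by zero off the
  complex and scaled by the number of subsets of the ground set. For \<open>x\<close> in the face space the
  coefficient at \<open>{}\<close> is \<open>1\<close>.
\<close>

definition pseudo_mass :: "nat set set \<Rightarrow> (nat set \<Rightarrow> real) \<Rightarrow> nat set \<Rightarrow> real" where
  "pseudo_mass \<Delta> x J = (\<Sum>F\<in>\<Delta>. (1 - 2 * x F) * walsh F J)"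

text \<open>
  The coefficients of the inequality are \<open>(1 + walsh F S) / 2\<close>, those of the cut vector
  of \<open>I\<close> are \<open>(1 - walsh F I) / 2\<close>. The right-hand side \<open>2 ^ (n - 2)\<close> is what makes the
  constant terms cancel: the factors \<open>1 + walsh F S\<close> vanish at every non-face \<open>F \<supseteq> {1..k}\<close>, as \<open>S\<close> is
  odd, and therefore their sum over the complex is the sum \<open>2 ^ n\<close> over all subsets of the ground set.
\<close>

lemma slack_switched_inequality:
  assumes k: "1 \<le> k" "k \<le> n" and x: "x \<in> face_space (TT n k)"
    and S: "S \<subseteq> {1..k}" "odd (card S)"
    and ab: "(a, b) = switch_wrt (TT n k) I (even_vector (TT n k) S, 2 powi (int n - 2))"
  shows "4 * (b - face_dot (TT n k) a x)
    = pseudo_mass (TT n k) x I + pseudo_mass (TT n k) x (sym_diff I S)"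
proof -
  let ?T = "TT n k" and ?N = "nonempty_faces (TT n k)"
  have x0: "x {} = 0" using x by (simp add: face_space_def nonempty_faces_def)
  have T: "?T = insert {} ?N" "{} \<notin> ?N" "finite ?N"
    using k finite_TT by (auto simp: nonempty_faces_def TT_def)
  have sum_T: "(\<Sum>F\<in>?T. h F) = h {} + (\<Sum>F\<in>?N. h F)" for h :: "nat set \<Rightarrow> real"
    using arg_cong[OF T(1), of "sum h"] T(2,3) by simp
  have finF: "finite F" if "F \<in> ?T" for F
    using that k by (meson finite_atLeastAtMost finite_subset mem_TT_iff)
  have c: "even_vector ?T S F = (1 + walsh F S) / 2" if "F \<in> ?N" for F
    using that by (simp add: even_vector_def walsh_eq_if Int_commute)
  have d: "cut_vector ?T I F = (1 - walsh F I) / 2" if "F \<in> ?N" for F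
    using that by (simp add: cut_vector_def walsh_eq_if)
  have a: "a F = walsh F I * even_vector ?T S F" for F
    using ab by (simp add: switch_wrt_def walsh_def Int_commute)
  have b: "b = 2 powi (int n - 2) - face_dot ?T (even_vector ?T S) (cut_vector ?T I)"
    using ab by (simp add: switch_wrt_def)
  have four: "4 * 2 powi (int n - 2) = (2 ^ n :: real)"
    by (simp add: power_int_diff)
  have "(\<Sum>F\<in>?T. 1 + walsh F S) = (\<Sum>F\<in>Pow {1..n}. 1 + walsh F S)"
    using k S by (intro sum_TT_eq_sum_Pow) (auto simp: walsh_superset)
  also have "\<dots> = 2 ^ n"
  proof -
    have "S \<subseteq> {1..n}" "S \<noteq> {}" using S k by auto
    then have "(\<Sum>F\<in>Pow {1..n}. walsh F S) = 0"
      using walsh_orthogonal[of "{1..n}" S "{}"] by (simp add: walsh_commute)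
    then show ?thesis by (simp add: sum.distrib card_Pow)
  qed
  finally have count: "2 ^ n = 2 + (\<Sum>F\<in>?N. 1 + walsh F S)"
    by (simp add: sum_T)
  have "4 * (b - face_dot ?T a x)
      = 2 ^ n - (\<Sum>F\<in>?N. 4 * (even_vector ?T S F * cut_vector ?T I F)) - (\<Sum>F\<in>?N. 4 * (a F * x F))"
    using four by (simp add: b face_dot_def algebra_simps sum_distrib_left)
  also have "\<dots> = 2 + (\<Sum>F\<in>?N. (1 + walsh F S)
      - 4 * (even_vector ?T S F * cut_vector ?T I F) - 4 * (a F * x F))"
    by (simp add: count sum_subtractf)
  also have "\<dots> = 2 + (\<Sum>F\<in>?N. (1 - 2 * x F) * (walsh F I * (1 + walsh F S)))"
    by (intro arg_cong[where f = "(+) 2"] sum.cong) (simp_all add: a c d field_simps)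
  also have "\<dots> = (\<Sum>F\<in>?T. (1 - 2 * x F) * (walsh F I * (1 + walsh F S)))"
    by (simp add: sum_T x0)
  also have "\<dots> = (\<Sum>F\<in>?T. (1 - 2 * x F) * walsh F I + (1 - 2 * x F) * walsh F (sym_diff I S))"
    by (rule sum.cong) (simp_all add: walsh_sym_diff[OF finF] algebra_simps)
  finally show ?thesis by (simp add: pseudo_mass_def sum.distrib)
qed

text \<open>
  The transform of the point mass at \<open>R\<close> completes the coefficients of the cut vector of \<open>R\<close>. In the
  sum of the two pseudo-masses the coefficients at the non-faces cancel, so they may be filled in
  from this completion; what remains is a sum of two values of a point mass.
\<close>

lemma pseudo_mass_cut_vector_pair_nonneg:
  assumes k: "k \<le> n" and R: "R \<subseteq> {1..n}" and I: "I \<subseteq> {1..n}"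
    and S: "S \<subseteq> {1..k}" "odd (card S)"
  defines "x \<equiv> cut_vector (TT n k) R"
  shows "0 \<le> pseudo_mass (TT n k) x I + pseudo_mass (TT n k) x (sym_diff I S)"
proof -
  have IS: "sym_diff I S \<subseteq> {1..n}" using I S k by auto
  have coeff: "1 - 2 * x F = walsh F R" if "F \<in> TT n k" for F
    using that by (auto simp: x_def cut_vector_def walsh_eq_if nonempty_faces_def)
  have "pseudo_mass (TT n k) x I + pseudo_mass (TT n k) x (sym_diff I S)
      = (\<Sum>F\<in>TT n k. walsh F R * walsh F I + walsh F R * walsh F (sym_diff I S))"
    by (simp add: pseudo_mass_def coeff sum.distrib)
  also have "\<dots> = (\<Sum>F\<in>Pow {1..n}. walsh F R * walsh F I + walsh F R * walsh F (sym_diff I S))"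
  proof (rule sum_TT_eq_sum_Pow[OF k])
    fix F :: "nat set" assume F: "F \<subseteq> {1..n}" "{1..k} \<subseteq> F"
    then have "finite F" using finite_subset by blast
    moreover have "walsh F S = -1" using F S by (simp add: walsh_superset)
    ultimately show "walsh F R * walsh F I + walsh F R * walsh F (sym_diff I S) = 0"
      by (simp add: walsh_sym_diff)
  qed
  also have "\<dots> = (\<Sum>F\<in>Pow {1..n}. walsh R F * walsh I F)
      + (\<Sum>F\<in>Pow {1..n}. walsh R F * walsh (sym_diff I S) F)"
    by (simp add: sum.distrib walsh_commute)
  also have "\<dots> \<ge> 0"
    using R I IS by (simp add: walsh_orthogonal)
  finally show ?thesis .
qed

section \<open>Completing a pseudo-mass to a distribution\<close>

lemma finite_sets_separated:
  fixes A B :: "real set"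
  assumes "finite A" "finite B" "\<And>a b. a \<in> A \<Longrightarrow> b \<in> B \<Longrightarrow> a \<le> b"
  shows "\<exists>g. (\<forall>a\<in>A. a \<le> g) \<and> (\<forall>b\<in>B. g \<le> b)"
proof (cases "A = {}")
  case True
  then show ?thesis using assms by (intro exI[of _ "Min B"]) auto
next
  case False
  then show ?thesis using assms by (intro exI[of _ "Max A"]) auto
qed

text \<open>
  For a fixed trace \<open>U = J - {1..k}\<close>, the \<open>J\<close> with an even number of elements in \<open>{1..k}\<close> bound the
  value \<open>g U\<close> from below and the others bound it from above. The hypothesis says that no lower bound
  exceeds an upper bound: given one \<open>J\<close> of each kind, their symmetric difference serves as \<open>S\<close>, and
  whichever of the two has even cardinality serves as \<open>I\<close>.
\<close>

lemma exists_nonnegative_completion: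
  fixes q :: "nat set \<Rightarrow> real"
  assumes k: "k \<le> n"
    and pair: "\<And>I S. I \<subseteq> {1..n} \<Longrightarrow> even (card I) \<Longrightarrow> S \<subseteq> {1..k} \<Longrightarrow> odd (card S)
      \<Longrightarrow> 0 \<le> q I + q (sym_diff I S)"
  obtains g where "\<And>J. J \<subseteq> {1..n} \<Longrightarrow> 0 \<le> q J + walsh {1..k} J * g (J - {1..k})"
proof -
  have "\<exists>g. \<forall>J. J \<subseteq> {1..n} \<longrightarrow> J - {1..k} = U \<longrightarrow> 0 \<le> q J + walsh {1..k} J * g" for U
  proof -
    define X where "X s = {J. J \<subseteq> {1..n} \<and> J - {1..k} = U \<and> walsh {1..k} J = s}" for s
    have fin: "finite (X s)" for s
      by (rule finite_subset[of _ "Pow {1..n}"]) (auto simp: X_def)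
    have "- q J \<le> q J'" if J: "J \<in> X 1" and J': "J' \<in> X (-1)" for J J'
    proof -
      define S where "S = sym_diff J J'"
      have S: "S \<subseteq> {1..k}" using J J' by (auto simp: S_def X_def)
      have "walsh {1..k} S = -1"
        using J J' by (simp add: S_def walsh_sym_diff X_def)
      then have odd: "odd (card S)" using S by (auto simp: walsh_superset)
      have diff: "sym_diff J S = J'" "sym_diff J' S = J" by (auto simp: S_def)
      have sub: "J \<subseteq> {1..n}" "J' \<subseteq> {1..n}" using J J' by (auto simp: X_def)
      have "walsh {1..n} S = -1" using S odd k by (subst walsh_superset) auto
      then have "walsh {1..n} J' = - walsh {1..n} J"
        using diff(1) walsh_sym_diff[of "{1..n}" J S] by simp
      then have "even (card J) \<or> even (card J')"
        using sub by (simp add: walsh_superset split: if_splits)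
      then have "0 \<le> q J + q J'"
        using pair[of J S] pair[of J' S] diff sub S odd by auto
      then show ?thesis by simp
    qed
    then have "a \<le> b" if "a \<in> (\<lambda>J. - q J) ` X 1" "b \<in> q ` X (-1)" for a b
      using that by blast
    from finite_sets_separated[OF finite_imageI[OF fin] finite_imageI[OF fin] this]
    obtain g where "(\<forall>a\<in>(\<lambda>J. - q J) ` X 1. a \<le> g) \<and> (\<forall>b\<in>q ` X (-1). g \<le> b)" ..
    then have g: "\<And>J. J \<in> X 1 \<Longrightarrow> - q J \<le> g" "\<And>J. J \<in> X (-1) \<Longrightarrow> g \<le> q J"
      by simp_all
    have "0 \<le> q J + walsh {1..k} J * g" if "J \<subseteq> {1..n}" "J - {1..k} = U" for J
    proof (cases "walsh {1..k} J = 1")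
      case True
      then show ?thesis using g(1)[of J] that by (simp add: X_def)
    next
      case False
      then have "walsh {1..k} J = -1" by (simp add: walsh_eq_if split: if_splits)
      then show ?thesis using g(2)[of J] that by (simp add: X_def)
    qed
    then show ?thesis by blast
  qed
  then obtain g where g: "\<forall>U J. J \<subseteq> {1..n} \<longrightarrow> J - {1..k} = U \<longrightarrow> 0 \<le> q J + walsh {1..k} J * g U"
    by metis
  show thesis
    by (rule that[of g]) (use g in simp)
qed

lemma pseudo_mass_coefficient:
  assumes "finite V" "\<Delta> \<subseteq> Pow V" "G \<in> \<Delta>"
  shows "(\<Sum>J\<in>Pow V. pseudo_mass \<Delta> x J * walsh G J) = 2 ^ card V * (1 - 2 * x G)"
proof -
  have "finite \<Delta>" using assms by (meson finite_Pow_iff finite_subset)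
  have "(\<Sum>J\<in>Pow V. pseudo_mass \<Delta> x J * walsh G J)
      = (\<Sum>J\<in>Pow V. \<Sum>F\<in>\<Delta>. (1 - 2 * x F) * (walsh F J * walsh G J))"
    by (simp add: pseudo_mass_def sum_distrib_right mult.assoc)
  also have "\<dots> = (\<Sum>F\<in>\<Delta>. (1 - 2 * x F) * (\<Sum>J\<in>Pow V. walsh F J * walsh G J))"
    by (subst sum.swap) (simp add: sum_distrib_left)
  also have "\<dots> = (\<Sum>F\<in>\<Delta>. if F = G then (1 - 2 * x F) * 2 ^ card V else 0)"
  proof (rule sum.cong[OF refl])
    fix F assume "F \<in> \<Delta>"
    then have "F \<subseteq> V" "G \<subseteq> V" using assms by auto
    then show "(1 - 2 * x F) * (\<Sum>J\<in>Pow V. walsh F J * walsh G J)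
        = (if F = G then (1 - 2 * x F) * 2 ^ card V else 0)"
      by (subst walsh_orthogonal[OF assms(1)]) simp_all
  qed
  also have "\<dots> = 2 ^ card V * (1 - 2 * x G)"
    using assms \<open>finite \<Delta>\<close> by simp
  finally show ?thesis .
qed

text \<open>
  A face misses some \<open>i \<in> {1..k}\<close>, and toggling \<open>i\<close> in \<open>J\<close> changes only the sign of \<open>walsh {1..k} J\<close>.
\<close>

lemma completion_coefficient_zero:
  assumes "k \<le> n" "G \<in> TT n k"
  shows "(\<Sum>J\<in>Pow {1..n}. walsh {1..k} J * g (J - {1..k}) * walsh G J) = 0"
proof -
  obtain i where i: "i \<in> {1..k}" "i \<notin> G" and G: "G \<subseteq> {1..n}"
    using assms unfolding mem_TT_iff[OF assms(1)] by blast
  have "finite G" using G finite_subset by blast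
  show ?thesis
  proof (rule sum_Pow_toggle_zero[of i])
    show "i \<in> {1..n}" using i assms by auto
    fix J
    have "sym_diff J {i} - {1..k} = J - {1..k}" using i by auto
    then show "walsh {1..k} (sym_diff J {i}) * g (sym_diff J {i} - {1..k}) * walsh G (sym_diff J {i})
        = - (walsh {1..k} J * g (J - {1..k}) * walsh G J)"
      using i \<open>finite G\<close> by (simp add: walsh_sym_diff walsh_singleton)
  qed
qed

section \<open>Membership in the polytope\<close>

lemma sum_function_apply: "(\<Sum>i\<in>A. f i) x = (\<Sum>i\<in>A. f i x)"
  for f :: "'i \<Rightarrow> 'a \<Rightarrow> real"
  by (induction A rule: infinite_finite_induct) simp_all

lemma mem_GCut_if_distribution:
  assumes x: "x \<in> face_space \<Delta>" and "{} \<in> \<Delta>"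
    and nonneg: "\<And>J. J \<subseteq> {1..n} \<Longrightarrow> 0 \<le> p J"
    and coeff: "\<And>F. F \<in> \<Delta> \<Longrightarrow> (\<Sum>J\<in>Pow {1..n}. p J * walsh F J) = 1 - 2 * x F"
  shows "x \<in> GCut n \<Delta>"
proof -
  have total: "(\<Sum>J\<in>Pow {1..n}. p J) = 1"
    using coeff[of "{}"] assms(2) x by (simp add: face_space_def nonempty_faces_def)
  have "(\<Sum>J\<in>Pow {1..n}. p J *\<^sub>R cut_vector \<Delta> J) = x"
  proof
    fix F
    show "(\<Sum>J\<in>Pow {1..n}. p J *\<^sub>R cut_vector \<Delta> J) F = x F"
    proof (cases "F \<in> nonempty_faces \<Delta>")
      case True
      then have "(\<Sum>J\<in>Pow {1..n}. p J *\<^sub>R cut_vector \<Delta> J) F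
          = (\<Sum>J\<in>Pow {1..n}. (p J - p J * walsh F J) / 2)"
        unfolding sum_function_apply
        by (intro sum.cong) (simp_all add: cut_vector_def walsh_eq_if)
      also have "\<dots> = x F"
        using True total coeff[of F]
        by (simp add: sum_subtractf nonempty_faces_def flip: sum_divide_distrib)
      finally show ?thesis .
    next
      case False
      then show ?thesis
        using x by (simp add: sum_function_apply cut_vector_def face_space_def)
    qed
  qed
  moreover have "(\<Sum>J\<in>Pow {1..n}. p J *\<^sub>R cut_vector \<Delta> J) \<in> GCut n \<Delta>"
    unfolding GCut_def
    by (rule convex_sum[OF _ convex_convex_hull total]) (use nonneg in \<open>auto intro!: hull_inc\<close>)
  ultimately show ?thesis by simp
qed

lemma convex_solution_set: "convex (solution_set \<Delta> Q)"
proof (rule convexI)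
  fix x y :: "nat set \<Rightarrow> real" and u v :: real
  assume x: "x \<in> solution_set \<Delta> Q" and y: "y \<in> solution_set \<Delta> Q"
    and uv: "0 \<le> u" "0 \<le> v" "u + v = 1"
  have "face_dot \<Delta> a (u *\<^sub>R x + v *\<^sub>R y) \<le> b" if "(a, b) \<in> Q" for a b
  proof -
    have "face_dot \<Delta> a (u *\<^sub>R x + v *\<^sub>R y) = u * face_dot \<Delta> a x + v * face_dot \<Delta> a y"
      by (simp add: face_dot_def sum_distrib_left algebra_simps sum.distrib)
    also have "\<dots> \<le> b"
      using that x y uv by (intro convex_bound_le) (auto simp: solution_set_def)
    finally show ?thesis .
  qed
  then show "u *\<^sub>R x + v *\<^sub>R y \<in> solution_set \<Delta> Q"
    using x y by (auto simp: solution_set_def face_space_def)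
qed

theorem theorem4p3:
  fixes n k :: nat
  assumes "1 \<le> k" and "k \<le> n"
  shows "GCut n (TT n k) =
    solution_set (TT n k)
      (switch (TT n k) {I. I \<subseteq> {1..n} \<and> even (card I)}
        {(even_vector (TT n k) S, 2 powi (int n - 2)) | S.
           S \<subseteq> {1..n} \<and> S \<inter> (\<Inter>i\<in>{1..k}. {1..n} - {i}) = {} \<and> odd (card S)})"
    (is "_ = solution_set ?T ?Q")
proof
  have odd_set_iff: "S \<subseteq> {1..n} \<and> S \<inter> (\<Inter>i\<in>{1..k}. {1..n} - {i}) = {} \<longleftrightarrow> S \<subseteq> {1..k}" for S
  proof -
    have "(\<Inter>i\<in>{1..k}. {1..n} - {i}) = {1..n} - {1..k}" using assms by auto
    then show ?thesis using assms by auto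
  qed
  have Q: "q \<in> ?Q \<longleftrightarrow> (\<exists>I S. I \<subseteq> {1..n} \<and> even (card I) \<and> S \<subseteq> {1..k} \<and> odd (card S)
      \<and> q = switch_wrt ?T I (even_vector ?T S, 2 powi (int n - 2)))" for q
    using odd_set_iff unfolding switch_def by blast
  have ball_Q: "(\<forall>q\<in>?Q. P q) \<longleftrightarrow>
      (\<forall>I S. I \<subseteq> {1..n} \<longrightarrow> even (card I) \<longrightarrow> S \<subseteq> {1..k} \<longrightarrow> odd (card S) \<longrightarrow>
        P (switch_wrt ?T I (even_vector ?T S, 2 powi (int n - 2))))" for P
    unfolding Ball_def Q by blast
  have solution_iff: "x \<in> solution_set ?T ?Q \<longleftrightarrow> x \<in> face_space ?T \<and>
      (\<forall>I S. I \<subseteq> {1..n} \<longrightarrow> even (card I) \<longrightarrow> S \<subseteq> {1..k} \<longrightarrow> odd (card S) \<longrightarrow>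
        0 \<le> pseudo_mass ?T x I + pseudo_mass ?T x (sym_diff I S))" (is "_ \<longleftrightarrow> _ \<and> ?pairs x") for x
  proof (cases "x \<in> face_space ?T")
    case True
    have slack: "(case switch_wrt ?T I (even_vector ?T S, 2 powi (int n - 2)) of
          (a, b) \<Rightarrow> face_dot ?T a x \<le> b)
        \<longleftrightarrow> 0 \<le> pseudo_mass ?T x I + pseudo_mass ?T x (sym_diff I S)"
      if "S \<subseteq> {1..k}" "odd (card S)" for I S
    proof -
      obtain a b where ab: "(a, b) = switch_wrt ?T I (even_vector ?T S, 2 powi (int n - 2))"
        by (metis surj_pair)
      show ?thesis
        using slack_switched_inequality[OF assms True that ab] unfolding ab[symmetric] by auto
    qed
    have "x \<in> solution_set ?T ?Q \<longleftrightarrow> (\<forall>q\<in>?Q. case q of (a, b) \<Rightarrow> face_dot ?T a x \<le> b)"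
      using True by (simp add: solution_set_def)
    also have "\<dots> \<longleftrightarrow> ?pairs x"
      unfolding ball_Q by (intro iff_allI imp_cong refl slack)
    finally show ?thesis using True by blast
  next
    case False
    then show ?thesis by (simp add: solution_set_def)
  qed
  show "GCut n ?T \<subseteq> solution_set ?T ?Q"
    unfolding GCut_def
  proof (rule hull_minimal, clarify)
    show "convex (solution_set ?T ?Q)" by (rule convex_solution_set)
    fix R :: "nat set" assume "R \<subseteq> {1..n}"
    moreover have "cut_vector ?T R \<in> face_space ?T"
      by (simp add: face_space_def cut_vector_def)
    ultimately show "cut_vector ?T R \<in> solution_set ?T ?Q"
      unfolding solution_iff using pseudo_mass_cut_vector_pair_nonneg[OF assms(2)] by blast
  qed
  show "solution_set ?T ?Q \<subseteq> GCut n ?T"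
  proof
    fix x assume "x \<in> solution_set ?T ?Q"
    then have x: "x \<in> face_space ?T" and pairs: "?pairs x"
      unfolding solution_iff by blast+
    obtain g where g: "\<And>J. J \<subseteq> {1..n} \<Longrightarrow>
        0 \<le> pseudo_mass ?T x J + walsh {1..k} J * g (J - {1..k})"
      using exists_nonnegative_completion[OF assms(2), of "pseudo_mass ?T x"] pairs by blast
    define p where "p J = (pseudo_mass ?T x J + walsh {1..k} J * g (J - {1..k})) / 2 ^ n" for J
    show "x \<in> GCut n ?T"
    proof (rule mem_GCut_if_distribution[OF x])
      show "{} \<in> ?T" using assms by (simp add: mem_TT_iff)
      show "0 \<le> p J" if "J \<subseteq> {1..n}" for J
        using g[OF that] by (simp add: p_def)
      show "(\<Sum>J\<in>Pow {1..n}. p J * walsh F J) = 1 - 2 * x F" if F: "F \<in> ?T" for F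
      proof -
        have "?T \<subseteq> Pow {1..n}" by (auto simp: TT_def)
        have "(\<Sum>J\<in>Pow {1..n}. p J * walsh F J)
            = ((\<Sum>J\<in>Pow {1..n}. pseudo_mass ?T x J * walsh F J)
              + (\<Sum>J\<in>Pow {1..n}. walsh {1..k} J * g (J - {1..k}) * walsh F J)) / 2 ^ n"
          by (simp add: p_def algebra_simps add_divide_distrib sum.distrib flip: sum_divide_distrib)
        also have "\<dots> = 1 - 2 * x F"
          using pseudo_mass_coefficient[OF _ \<open>?T \<subseteq> Pow {1..n}\<close> F, of x]
            completion_coefficient_zero[OF assms(2) F, of g] by simp
        finally show ?thesis .
      qed
    qed
  qed
qed

end
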